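(* When the two-step algorithm of the context is run with the unbiased estimator and the Laplace query in Step 2 (with an arbitrary assignment $\rho$), its output $\tilde k$ satisfies $$\mathbb{E}\big[(\tilde k-f(G))^2\big]=O\!\left(\frac{d_{\max}}{\varepsilon_1^4\varepsilon_2^2}m+\frac{|\Delta|}{\varepsilon_1^3}+\frac{\#C'_4}{\varepsilon_1^3}\right).$$
   Context: Let $G=(V,E,w)$ be a finite simple undirected graph, $V=\{1,\dots,n\}$, $m=|E|$, maximum degree $d_{\max}$, integer weights $w_{uv}=w_{vu}$; $\mathcal N(v)$ is the neighborhood of $v$, $w^v=(w_{vu})_{u\in\mathcal N(v)}$. Let $\Delta$ be the set of triangles, $w_T$ the sum of the three edge weights of $T$, $\lambda\in\mathbb{Z}$, and $f(G)=|\{T\in\Delta:w_T<\lambda\}|$. Let $\varepsilon_1,\varepsilon_2>0$, $p=e^{-\varepsilon_1}$; $\mathrm{DLap}(p)$ has mass $\frac{1-p}{1+p}p^{|i|}$ at $i\in\mathbb{Z}$; $\mathrm{Lap}(b)$ has density $\frac1{2b}e^{-|y|/b}$. Define $h:\mathbb{Z}\to\mathbb{R}$ by $h(k)=0$ for $k>\lambda$, $h(\lambda)=-\frac{p}{(1-p)^2}$, $h(\lambda-1)=1+\frac{p}{(1-p)^2}$, $h(k)=1$ for $k<\lambda-1$. Algorithm: Step 1: each $v$ reports $\tilde w_{vu}=w_{vu}+Y_{vu}$ for $u\in\mathcal N(v)$, all $Y_{vu}$ i.i.d. $\mathrm{DLap}(p)$; for each edge set $w'_{uv}=w'_{vu}=\tilde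 w_{uv}$ if $u<v$ and $\tilde w_{vu}$ otherwise. An assignment $\rho:\Delta\to V$ with $\rho(T)\in T$ is fixed, $\Delta_v=\rho^{-1}(v)$. Step 2: node $v$ computes $f'_v(w^v)=\sum_{T=\{v,u,x\}\in\Delta_v}h(w_{vu}+w_{vx}+w'_{ux})$ (unbiased estimator), regarded as a function of $w^v$ with the $w'$ fixed, and releases $\tilde f_v=f'_v(w^v)+L_v$ with $L_v\sim\mathrm{Lap}(GS(f'_v)/\varepsilon_2)$ independent, where $GS(f'_v)=\max\{|f'_v(a)-f'_v(b)|:\|a-b\|_1\le1\}$. Output $\tilde k=\sum_v\tilde f_v$. For $e=\{x,y\}\in E$ let $l(e)=|\{T\in\Delta:e\subseteq T,\ \rho(T)\notin e\}|$ and $\#C'_4=\sum_{e\in E}\binom{l(e)}{2}$.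
   Formalization: The bound is proved for ε₁ ≤ B with B arbitrary, the O-constant depending only on B; with unbounded ε₁ it fails: for one triangle and ε₂ = 1 the Laplace noise has variance at least 2 while the claimed bound tends to 0 as ε₁ → ∞. *)

theory Defs
  imports "HOL-Probability.Probability"
begin

definition simple_graph :: "nat \<Rightarrow> nat set set \<Rightarrow> bool" where
  "simple_graph n E \<longleftrightarrow> E \<subseteq> {{u, v} | u v. u \<in> {1..n} \<and> v \<in> {1..n} \<and> u \<noteq> v}"

definition nbhd :: "nat set set \<Rightarrow> nat \<Rightarrow> nat set" where
  "nbhd E v = {u. {v, u} \<in> E}"

definition max_degree :: "nat \<Rightarrow> nat set set \<Rightarrow> nat" where
  "max_degree n E = (MAX v\<in>{1..n}. card (nbhd E v))"

definition triangles :: "nat set set \<Rightarrow> nat set set" where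
  "triangles E = {{u, v, x} | u v x. {u, v} \<in> E \<and> {v, x} \<in> E \<and> {u, x} \<in> E \<and>
     u \<noteq> v \<and> v \<noteq> x \<and> u \<noteq> x}"

definition triangle_weight :: "(nat \<Rightarrow> nat \<Rightarrow> int) \<Rightarrow> nat set \<Rightarrow> int" where
  "triangle_weight w T = (\<Sum>(u, v) \<in> {(u, v). u \<in> T \<and> v \<in> T \<and> u < v}. w u v)"

definition below_count :: "nat set set \<Rightarrow> (nat \<Rightarrow> nat \<Rightarrow> int) \<Rightarrow> int \<Rightarrow> nat" where
  "below_count E w lam = card {T \<in> triangles E. triangle_weight w T < lam}"

definition dlap :: "real \<Rightarrow> int pmf" where
  "dlap p = embed_pmf (\<lambda>i. (1 - p) / (1 + p) * p ^ nat \<bar>i\<bar>)"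

text \<open>\<open>embed_pmf\<close> is only meaningful for mass functions of total mass one.\<close>

lemma pmf_dlap:
  assumes "0 < p" "p < 1"
  shows "pmf (dlap p) i = (1 - p) / (1 + p) * p ^ nat \<bar>i\<bar>"
  unfolding dlap_def
proof (rule pmf_embed_pmf)
  let ?c = "(1 - p) / (1 + p)"
  let ?g = "\<lambda>i::int. ennreal (?c * p ^ nat \<bar>i\<bar>)"
  show "0 \<le> ?c * p ^ nat \<bar>j\<bar>" for j using assms by simp
  have geo: "(\<lambda>k. p ^ k) sums (1 / (1 - p))" using assms by (intro geometric_sums) auto
  have s1: "(\<lambda>k. ?c * p ^ k) sums (1 / (1 + p))"
    using sums_mult[OF geo, of ?c] assms by simp
  have s2: "(\<lambda>k. ?c * p ^ Suc k) sums (p / (1 + p))"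
    using sums_mult[OF s1, of p] by (simp add: mult_ac)
  have b1: "bij_betw int UNIV {0..}"
    by (rule bij_betwI[where g = nat]) auto
  have b2: "bij_betw (\<lambda>k. - int k - 1) UNIV {..<0}"
    by (rule bij_betwI[where g = "\<lambda>i. nat (- i - 1)"]) auto
  have "(\<integral>\<^sup>+ i. ?g i \<partial>count_space UNIV)
      = (\<integral>\<^sup>+ i. ?g i * indicator {0..} i + ?g i * indicator {..<0} i \<partial>count_space UNIV)"
    by (intro nn_integral_cong) (auto simp: indicator_def)
  also have "\<dots> = (\<integral>\<^sup>+ i. ?g i \<partial>count_space {0..}) + (\<integral>\<^sup>+ i. ?g i \<partial>count_space {..<0})"
    by (simp add: nn_integral_add nn_integral_count_space_indicator)
  also have "(\<integral>\<^sup>+ i. ?g i \<partial>count_space {0..}) = (\<integral>\<^sup>+ k. ?g (int k) \<partial>count_space UNIV)"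
    by (rule nn_integral_bij_count_space[OF b1, symmetric])
  also have "\<dots> = ennreal (1 / (1 + p))"
    using s1 assms by (simp add: nn_integral_count_space_nat suminf_ennreal_eq sums_iff)
  also have "(\<integral>\<^sup>+ i. ?g i \<partial>count_space {..<0})
      = (\<integral>\<^sup>+ k. ?g (- int k - 1) \<partial>count_space UNIV)"
    by (rule nn_integral_bij_count_space[OF b2, symmetric])
  also have "\<dots> = (\<integral>\<^sup>+ k. ennreal (?c * p ^ Suc k) \<partial>count_space UNIV)"
  proof (intro nn_integral_cong)
    fix k :: nat
    have "nat \<bar>- int k - 1\<bar> = Suc k" by simp
    then show "?g (- int k - 1) = ennreal (?c * p ^ Suc k)" by (simp only:)
  qed
  also have "\<dots> = (\<Sum>k. ennreal (?c * p ^ Suc k))"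
    by (rule nn_integral_count_space_nat)
  also have "\<dots> = ennreal (p / (1 + p))"
    by (rule suminf_ennreal_eq[OF _ s2]) (use assms in simp)
  also have "ennreal (1 / (1 + p)) + ennreal (p / (1 + p)) = 1"
    using assms by (simp add: ennreal_plus[symmetric] add_divide_distrib[symmetric] del: ennreal_plus)
  finally show "(\<integral>\<^sup>+ i. ?g i \<partial>count_space UNIV) = 1" .
qed

text \<open>The scale \<open>b = 0\<close> occurs when the released query is constant (for instance at a node
  that has no assigned triangle); then no noise is added.\<close>

definition laplace :: "real \<Rightarrow> real measure" where
  "laplace b = (if b = 0 then return borel 0
     else density lborel (\<lambda>y. ennreal (exp (- \<bar>y\<bar> / b) / (2 * b))))"

definition h :: "real \<Rightarrow> int \<Rightarrow> int \<Rightarrow> real" where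
  "h p lam k =
     (if k > lam then 0
      else if k = lam then - (p / (1 - p)\<^sup>2)
      else if k = lam - 1 then 1 + p / (1 - p)\<^sup>2
      else 1)"

text \<open>\<open>Y (v, u)\<close> is the noise added by node \<open>v\<close> to its own copy of the weight of \<open>{v, u}\<close>.\<close>

definition arcs :: "nat set set \<Rightarrow> (nat \<times> nat) set" where
  "arcs E = {(v, u). {v, u} \<in> E}"

definition noisy_weight ::
  "(nat \<Rightarrow> nat \<Rightarrow> int) \<Rightarrow> (nat \<times> nat \<Rightarrow> int) \<Rightarrow> nat \<Rightarrow> nat \<Rightarrow> int" where
  "noisy_weight w Y u v = (if u < v then w u v + Y (u, v) else w v u + Y (v, u))"

text \<open>A triangle \<open>{v, u, x}\<close> assigned to \<open>v\<close> is enumerated once, through its two other vertices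
  with \<open>u < x\<close>. The argument \<open>a\<close> plays the role of the private vector \<open>w\<^sup>v\<close>; only its values
  on the neighbourhood of \<open>v\<close> matter.\<close>

definition local_est ::
  "real \<Rightarrow> int \<Rightarrow> nat set set \<Rightarrow> (nat set \<Rightarrow> nat) \<Rightarrow> (nat \<Rightarrow> nat \<Rightarrow> int) \<Rightarrow> nat \<Rightarrow>
     (nat \<Rightarrow> int) \<Rightarrow> real" where
  "local_est p lam E \<rho> w' v a =
     (\<Sum>(u, x) \<in> {(u, x). u < x \<and> {v, u, x} \<in> triangles E \<and> \<rho> {v, u, x} = v}.
        h p lam (a u + a x + w' u x))"

definition global_sens :: "nat set \<Rightarrow> ((nat \<Rightarrow> int) \<Rightarrow> real) \<Rightarrow> real" where
  "global_sens N F = Max {\<bar>F a - F b\<bar> | a b. (\<Sum>u\<in>N. \<bar>a u - b u\<bar>) \<le> 1}"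

text \<open>The maximum is over a finite set, since \<open>local_est\<close> has finite range.\<close>

lemma finite_range_local_est:
  assumes "simple_graph n E"
  shows "finite (range (local_est p lam E \<rho> w' v))"
proof -
  let ?I = "{(u, x). u < x \<and> {v, u, x} \<in> triangles E \<and> \<rho> {v, u, x} = v}"
  let ?H = "{0, - (p / (1 - p)\<^sup>2), 1 + p / (1 - p)\<^sup>2, 1}"
  have sub: "\<Union>(triangles E) \<subseteq> {1..n}"
    using assms by (fastforce simp: triangles_def simple_graph_def doubleton_eq_iff)
  have "?I \<subseteq> {1..n} \<times> {1..n}" using sub by blast
  then have fin: "finite ?I" by (rule finite_subset) simp
  have "range (local_est p lam E \<rho> w' v) \<subseteq> (\<lambda>g. sum g ?I) ` (?I \<rightarrow>\<^sub>E ?H)"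
  proof (rule image_subsetI)
    fix a
    let ?g = "restrict (\<lambda>(u, x). h p lam (a u + a x + w' u x)) ?I"
    have "?g \<in> ?I \<rightarrow>\<^sub>E ?H" by (auto simp: h_def)
    moreover have "local_est p lam E \<rho> w' v a = sum ?g ?I"
      unfolding local_est_def by (rule sum.cong) auto
    ultimately show "local_est p lam E \<rho> w' v a \<in> (\<lambda>g. sum g ?I) ` (?I \<rightarrow>\<^sub>E ?H)" by blast
  qed
  moreover have "finite (?I \<rightarrow>\<^sub>E ?H)" by (rule finite_PiE[OF fin]) simp
  ultimately show ?thesis by (meson finite_imageI finite_subset)
qed

lemma finite_sens_set:
  fixes F :: "(nat \<Rightarrow> int) \<Rightarrow> real"
  assumes "finite (range F)"
  shows "finite {\<bar>F a - F b\<bar> | a b. (\<Sum>u\<in>N. \<bar>a u - b u\<bar>) \<le> (1::int)}"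
proof (rule finite_subset)
  show "{\<bar>F a - F b\<bar> | a b. (\<Sum>u\<in>N. \<bar>a u - b u\<bar>) \<le> (1::int)}
      \<subseteq> (\<lambda>(s, t). \<bar>s - t\<bar>) ` (range F \<times> range F)" by auto
  show "finite ((\<lambda>(s, t). \<bar>s - t\<bar>) ` (range F \<times> range F))" using assms by simp
qed

text \<open>The law of the output. The scales of the Laplace variables depend on the outcome \<open>Y\<close> of
  Step 1; given \<open>Y\<close>, they are independent.\<close>

definition two_step ::
  "nat \<Rightarrow> nat set set \<Rightarrow> (nat \<Rightarrow> nat \<Rightarrow> int) \<Rightarrow> int \<Rightarrow> (nat set \<Rightarrow> nat) \<Rightarrow> real \<Rightarrow> real \<Rightarrow>
     real measure" where
  "two_step n E w lam \<rho> \<epsilon>1 \<epsilon>2 =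
     (let p = exp (- \<epsilon>1) in
      measure_pmf (Pi_pmf (arcs E) 0 (\<lambda>_. dlap p)) \<bind>
        (\<lambda>Y. let f' = local_est p lam E \<rho> (noisy_weight w Y) in
           distr (PiM {1..n} (\<lambda>v. laplace (global_sens (nbhd E v) (f' v) / \<epsilon>2))) borel
             (\<lambda>L. \<Sum>v=1..n. (f' v (w v) + L v))))"

definition opp_count :: "nat set set \<Rightarrow> (nat set \<Rightarrow> nat) \<Rightarrow> nat set \<Rightarrow> nat" where
  "opp_count E \<rho> e = card {T \<in> triangles E. e \<subseteq> T \<and> \<rho> T \<notin> e}"

definition c4_count :: "nat set set \<Rightarrow> (nat set \<Rightarrow> nat) \<Rightarrow> nat" where
  "c4_count E \<rho> = (\<Sum>e\<in>E. opp_count E \<rho> e choose 2)"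

end

(* Given the noise of Step 1, the Laplace variables are independent and centred, so the mean squared
   error is the square of the Step 1 error plus the sum of the variances 2 GS^2 / eps2^2. A unit
   change of the private vector at v affects at most deg v triangles, each by O(1 / (1 - p)^2),
   and the sum of deg^2 is at most 2 d_max m.

   The function h is g - p / (1 - p)^2 times the second difference of g, where g is the indicator
   of k < lam; this undoes the DLap smoothing, so every triangle is estimated without bias, with
   second moment O(1 / (1 - p)^3). The Step 1 noise seen by a triangle is that of the edge opposite
   to its assigned vertex. Grouping triangles by this edge makes the Step 1 error a sum of
   independent centred terms, and Cauchy-Schwarz inside a group of size l gives
   l^2 = l + 2 binom(l, 2), hence the terms in |triangles| and #C4'. Finally 1 - p is at least
   eps1 exp(-B) for eps1 at most B. *)

theory Submission
  imports Defs
begin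

section \<open>Probability\<close>

text \<open>Independence and centring kill the cross terms. The constant \<open>c\<close> allows
  Laplace noise to be added to a fixed Step 1 error. Integrability belongs to the induction, since
  the integral of the square splits only with it.\<close>

lemma (in prob_space) bienayme:
  fixes X :: "'i \<Rightarrow> 'a \<Rightarrow> real"
  assumes "finite I" "indep_vars (\<lambda>_. borel) X I"
    and "\<And>i. i \<in> I \<Longrightarrow> integrable M (\<lambda>\<omega>. (X i \<omega>)\<^sup>2)"
    and "\<And>i. i \<in> I \<Longrightarrow> expectation (X i) = 0"
  shows "integrable M (\<lambda>\<omega>. (c + (\<Sum>i\<in>I. X i \<omega>))\<^sup>2) \<and>
    expectation (\<lambda>\<omega>. (c + (\<Sum>i\<in>I. X i \<omega>))\<^sup>2) = c\<^sup>2 + (\<Sum>i\<in>I. expectation (\<lambda>\<omega>. (X i \<omega>)\<^sup>2))"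
  using assms
proof (induction I rule: finite_induct)
  case empty
  then show ?case by (simp add: prob_space)
next
  case (insert i I)
  let ?S = "\<lambda>\<omega>. \<Sum>i\<in>I. X i \<omega>"
  have rv: "X j \<in> borel_measurable M" if "j \<in> insert i I" for j
    using insert.prems(1) that by (auto simp: indep_vars_def)
  have int: "integrable M (X j)" if "j \<in> insert i I" for j
    using square_integrable_imp_integrable[OF rv insert.prems(2)] that by blast
  have "indep_vars (\<lambda>_. borel) X I"
    using insert.prems(1) by (rule indep_vars_subset) auto
  then have IH: "integrable M (\<lambda>\<omega>. (c + ?S \<omega>)\<^sup>2)"
    "expectation (\<lambda>\<omega>. (c + ?S \<omega>)\<^sup>2) = c\<^sup>2 + (\<Sum>i\<in>I. expectation (\<lambda>\<omega>. (X i \<omega>)\<^sup>2))"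
    using insert.IH insert.prems by auto
  have ind: "indep_var borel (X i) borel ?S"
    using insert.hyps insert.prems(1) by (intro indep_vars_sum)
  have intS: "integrable M ?S" using int by auto
  have prod: "integrable M (\<lambda>\<omega>. X i \<omega> * ?S \<omega>)" "expectation (\<lambda>\<omega>. X i \<omega> * ?S \<omega>) = 0"
    using indep_var_integrable[OF ind] indep_var_lebesgue_integral[OF ind] int intS insert.prems(3)
    by auto
  \<comment> \<open>With the new summand separated, the linear term vanishes by centring, the mixed
    term by independence, and the last square is covered by the induction hypothesis.\<close>
  have eq: "(c + (\<Sum>i\<in>insert i I. X i \<omega>))\<^sup>2
      = (X i \<omega>)\<^sup>2 + (2 * c * X i \<omega> + 2 * (X i \<omega> * ?S \<omega>) + (c + ?S \<omega>)\<^sup>2)" for \<omega>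
    using insert.hyps by (simp add: power2_eq_square algebra_simps)
  show ?case
    unfolding eq using insert.hyps insert.prems int prod IH by simp
qed

section \<open>Laplace noise\<close>

text \<open>For \<open>b > 0\<close> the density is, off 0, the mean of the exponential density of
  rate \<open>1 / b\<close> and its reflection, so the even moments are the exponential ones; the
  first moment vanishes by reflection. For \<open>b = 0\<close> the law is a point mass at
  0.\<close>

lemma laplace_moments:
  assumes "b \<ge> 0"
  shows "prob_space (laplace b)"
    and "integrable (laplace b) (\<lambda>y. y\<^sup>2)" and "(\<integral>y. y\<^sup>2 \<partial>laplace b) = 2 * b\<^sup>2"
    and "(\<integral>y. y \<partial>laplace b) = 0"
proof -
  have "prob_space (laplace b) \<and> integrable (laplace b) (\<lambda>y. y\<^sup>2) \<and> (\<integral>y. y\<^sup>2 \<partial>laplace b) = 2 * b\<^sup>2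
    \<and> (\<integral>y. y \<partial>laplace b) = 0"
  proof (cases "b = 0")
    case True
    then show ?thesis
      by (auto simp: laplace_def integral_return integrable_iff_bounded nn_integral_return
          intro: prob_space_return)
  next
    case False
    with assms have b: "b > 0" by simp
    let ?f = "\<lambda>y. exp (- \<bar>y\<bar> / b) / (2 * b)"
    let ?e = "exponential_density (1 / b)"
    have lap: "laplace b = density lborel (\<lambda>y. ennreal (?f y))"
      using False by (simp add: laplace_def)
    \<comment> \<open>\<open>k = 0\<close> gives the total mass and \<open>k = 1\<close> the second
      moment. Even powers keep the integrand nonnegative, so no integrability has to be known
      beforehand.\<close>
    have mom: "(\<integral>\<^sup>+y. ennreal (y ^ (2 * k)) \<partial>laplace b) = ennreal (fact (2 * k) * b ^ (2 * k))" for k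
    proof -
      let ?g = "\<lambda>y. ennreal (?e y * y ^ (2 * k))"
      have "(\<integral>\<^sup>+y. ennreal (y ^ (2 * k)) \<partial>laplace b) = (\<integral>\<^sup>+y. ennreal (?f y) * ennreal (y ^ (2 * k)) \<partial>lborel)"
        unfolding lap by (subst nn_integral_density) auto
      \<comment> \<open>The reflection is written \<open>0 + (-1) * y\<close> to match the affine
        substitution rule applied below.\<close>
      also have "\<dots> = (\<integral>\<^sup>+y. ennreal (1/2) * (?g y + ?g (0 + (-1) * y)) \<partial>lborel)"
      proof (intro nn_integral_cong_AE)
        \<comment> \<open>At \<open>y = 0\<close> both exponential densities are positive, so for
          \<open>k = 0\<close> the right side is twice the left; a single point is null.\<close>
        show "AE y in lborel. ennreal (?f y) * ennreal (y ^ (2 * k)) = ennreal (1/2) * (?g y + ?g (0 + (-1) * y))"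
          using AE_lborel_singleton[of 0]
        proof eventually_elim
          case (elim y)
          have eq: "?f y * y ^ (2 * k)
              = 1/2 * (?e y * y ^ (2 * k) + ?e (0 + (-1) * y) * (0 + (-1) * y) ^ (2 * k))"
            using elim b by (cases "y < 0") (auto simp: exponential_density_def)
          have "ennreal (?f y) * ennreal (y ^ (2 * k)) = ennreal (?f y * y ^ (2 * k))"
            using b by (intro ennreal_mult[symmetric]) auto
          also have "\<dots> = ennreal (1/2) * (?g y + ?g (0 + (-1) * y))"
            unfolding eq using b
            by (subst ennreal_mult, simp, simp add: exponential_density_nonneg,
                subst ennreal_plus, auto simp: exponential_density_nonneg)
          finally show ?case .
        qed
      qed
      also have "\<dots> = ennreal (1/2) * ((\<integral>\<^sup>+y. ?g y \<partial>lborel) + (\<integral>\<^sup>+y. ?g (0 + (-1) * y) \<partial>lborel))"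
        by (subst nn_integral_cmult, measurable, subst nn_integral_add, auto)
      also have "(\<integral>\<^sup>+y. ?g (0 + (-1) * y) \<partial>lborel) = (\<integral>\<^sup>+y. ?g y \<partial>lborel)"
        by (subst nn_integral_real_affine[where c="-1" and t=0, of ?g]) auto
      also have "(\<integral>\<^sup>+y. ?g y \<partial>lborel) = ennreal (fact (2 * k) * b ^ (2 * k))"
        using b by (subst nn_integral_erlang_ith_moment) (auto simp: power_one_over field_simps)
      also have "ennreal (1/2) * (ennreal x + ennreal x) = ennreal x" if "x \<ge> 0" for x
        unfolding ennreal_plus[OF that that, symmetric]
        by (subst ennreal_mult[symmetric]) (use that in auto)
      finally show ?thesis using b by simp
    qed
    have "prob_space (laplace b)"
      using mom[of 0] by (intro prob_spaceI) simp
    moreover have hb: "has_bochner_integral (laplace b) (\<lambda>y. y\<^sup>2) (2 * b\<^sup>2)"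
      using mom[of 1] b by (intro has_bochner_integral_nn_integral) (auto simp: lap fact_2 numeral_2_eq_2)
    moreover have "(\<integral>y. y \<partial>laplace b) = 0"
    proof -
      have "(\<integral>y. y \<partial>laplace b) = (\<integral>y. ?f y * y \<partial>lborel)"
        unfolding lap using b by (subst integral_density) auto
      moreover have "(\<integral>y. ?f y * y \<partial>lborel) = - (\<integral>y. ?f y * y \<partial>lborel)"
        by (subst lborel_integral_real_affine[where c="-1" and t=0]) auto
      ultimately show ?thesis by simp
    qed
    ultimately show ?thesis by (auto simp: has_bochner_integral_iff)
  qed
  then show "prob_space (laplace b)" "integrable (laplace b) (\<lambda>y. y\<^sup>2)" "(\<integral>y. y\<^sup>2 \<partial>laplace b) = 2 * b\<^sup>2"
    "(\<integral>y. y \<partial>laplace b) = 0" by blast+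
qed

lemma sets_laplace [simp, measurable_cong]: "sets (laplace b) = sets borel"
  by (simp add: laplace_def)

text \<open>Independence is read off the joint law: the tuple of coordinates is the identity on the
  product space, and each marginal is the corresponding factor.\<close>

lemma indep_vars_PiM_components:
  assumes "I \<noteq> {}" "\<And>i. i \<in> I \<Longrightarrow> prob_space (M i)"
  shows "prob_space.indep_vars (PiM I M) M (\<lambda>i \<omega>. \<omega> i) I"
proof -
  interpret prob_space "PiM I M" by (rule prob_space_PiM) fact
  have "distr (PiM I M) (PiM I M) (\<lambda>x. \<lambda>i\<in>I. x i) = PiM I M"
    using distr_cong[of "PiM I M" "PiM I M" "PiM I M" "PiM I M" "\<lambda>x. \<lambda>i\<in>I. x i" "\<lambda>x. x"]
    by (simp add: space_PiM distr_id)
  also have "\<dots> = PiM I (\<lambda>i. distr (PiM I M) (M i) (\<lambda>\<omega>. \<omega> i))"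
    by (intro PiM_cong refl distr_PiM_component[symmetric] assms)
  finally show ?thesis
    using assms by (subst indep_vars_iff_distr_eq_PiM') auto
qed

text \<open>This serves as the inner integral over the noise of Step 2, with \<open>c\<close> the
  Step 1 error; hence the nonnegative integral.\<close>

lemma laplace_sum_second_moment:
  assumes "finite I" "\<And>i. i \<in> I \<Longrightarrow> b i \<ge> 0"
  shows "(\<integral>\<^sup>+L. ennreal ((c + (\<Sum>i\<in>I. L i))\<^sup>2) \<partial>PiM I (\<lambda>i. laplace (b i)))
    = ennreal (c\<^sup>2 + (\<Sum>i\<in>I. 2 * (b i)\<^sup>2))"
\<comment> \<open>The empty product is split off because independence of the coordinates is
  available for nonempty \<open>I\<close>.\<close>
proof (cases "I = {}")
  case True
  interpret prob_space "PiM I (\<lambda>i. laplace (b i))" by (rule prob_space_PiM) (simp add: True)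
  show ?thesis using True emeasure_space_1 by simp
next
  case False
  let ?M = "PiM I (\<lambda>i. laplace (b i))"
  have ps: "prob_space (laplace (b i))" if "i \<in> I" for i
    using laplace_moments(1) assms that by blast
  interpret prob_space ?M by (rule prob_space_PiM) (rule ps)
  have comp: "distr ?M (laplace (b i)) (\<lambda>\<omega>. \<omega> i) = laplace (b i)" if "i \<in> I" for i
    using that by (intro distr_PiM_component ps)
  have ind: "indep_vars (\<lambda>_. borel) (\<lambda>i \<omega>. \<omega> i) I"
    by (rule indep_vars_compose2[where X="\<lambda>i \<omega>. \<omega> i" and Y="\<lambda>_ x. x", OF indep_vars_PiM_components])
       (auto simp: False ps)
  have 1: "integrable ?M (\<lambda>\<omega>. (\<omega> i)\<^sup>2)" "expectation (\<lambda>\<omega>. (\<omega> i)\<^sup>2) = 2 * (b i)\<^sup>2"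
     "expectation (\<lambda>\<omega>. \<omega> i) = 0" if "i \<in> I" for i
  proof -
    have m: "(\<lambda>\<omega>. \<omega> i) \<in> measurable ?M (laplace (b i))"
      using that by measurable
    note L = laplace_moments[OF assms(2)[OF that]]
    show "integrable ?M (\<lambda>\<omega>. (\<omega> i)\<^sup>2)"
      using integrable_distr[OF m, of "\<lambda>y. y\<^sup>2"] L comp[OF that] by simp
    show "expectation (\<lambda>\<omega>. (\<omega> i)\<^sup>2) = 2 * (b i)\<^sup>2"
      using integral_distr[OF m, of "\<lambda>y. y\<^sup>2"] L comp[OF that] by simp
    show "expectation (\<lambda>\<omega>. \<omega> i) = 0"
      using integral_distr[OF m, of "\<lambda>y. y"] L comp[OF that] by simp
  qed
  have "integrable ?M (\<lambda>L. (c + (\<Sum>i\<in>I. L i))\<^sup>2) \<and>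
    expectation (\<lambda>L. (c + (\<Sum>i\<in>I. L i))\<^sup>2) = c\<^sup>2 + (\<Sum>i\<in>I. expectation (\<lambda>\<omega>. (\<omega> i)\<^sup>2))"
    using 1 by (intro bienayme assms(1) ind) auto
  then show ?thesis
    using 1(2) by (simp add: nn_integral_eq_integral)
qed

section \<open>Discrete Laplace noise and the unbiased estimator\<close>

lemma expectation_h_dlap:
  assumes p: "0 < p" "p < 1"
  shows "measure_pmf.expectation (dlap p) (\<lambda>y. h p lam (k + y)) = of_bool (k < lam)"
proof -
  let ?D = "measure_pmf (dlap p)"
  define a where "a = p / (1 - p)\<^sup>2"
  define F where "F j = measure ?D {..<j} + a * (pmf (dlap p) (j - 1) - pmf (dlap p) j)" for j
  note pmf = pmf_dlap[OF p]
  \<comment> \<open>\<open>F\<close> is the claimed expectation at \<open>lam - k = j\<close>. It jumps only at \<open>0\<close>, because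
    \<open>2 - p - 1 / p = - 1 / a\<close>, and the symmetry of the noise gives \<open>F 0 + F 1 = 1\<close>.\<close>
  have step: "F (j + 1) - F j = of_bool (j = 0)" for j
  proof -
    have "{..<j + 1} = insert j {..<j}" by auto
    then have "measure ?D {..<j + 1} = pmf (dlap p) j + measure ?D {..<j}"
      by (simp add: measure_pmf.finite_measure_Union[of "{j}" "dlap p" "{..<j}", simplified] measure_pmf_single)
    then have "F (j + 1) - F j = pmf (dlap p) j + a * (2 * pmf (dlap p) j - pmf (dlap p) (j - 1) - pmf (dlap p) (j + 1))"
      by (simp add: F_def algebra_simps)
    also have "\<dots> = of_bool (j = 0)"
    proof -
      consider "j = 0" | "j > 0" | "j < 0" by linarith
      then show ?thesis
      proof cases
        case 1
        show ?thesis using 1 p by (simp add: pmf a_def power2_eq_square divide_simps) (simp add: algebra_simps)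
      next
        case 2
        \<comment> \<open>All exponents are expressed through the smallest one, that of
          \<open>j - 1\<close>. A common power of \<open>p\<close> factors out and
          \<open>p - a * (1 - p)^2 = 0\<close> remains.\<close>
        then have *: "nat \<bar>j\<bar> = Suc (nat \<bar>j - 1\<bar>)" "nat \<bar>j + 1\<bar> = Suc (Suc (nat \<bar>j - 1\<bar>))" by auto
        show ?thesis using 2 p unfolding pmf * by (simp add: a_def power2_eq_square divide_simps) (simp add: algebra_simps)
      next
        case 3
        then have *: "nat \<bar>j\<bar> = Suc (nat \<bar>j + 1\<bar>)" "nat \<bar>j - 1\<bar> = Suc (Suc (nat \<bar>j + 1\<bar>))" by auto
        show ?thesis using 3 p unfolding pmf * by (simp add: a_def power2_eq_square divide_simps) (simp add: algebra_simps)
      qed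
    qed
    finally show ?thesis .
  qed
  have sym: "map_pmf uminus (dlap p) = dlap p"
  proof (rule pmf_eqI)
    fix i :: int
    have "pmf (map_pmf uminus (dlap p)) (- (- i)) = pmf (dlap p) (- i)"
      by (rule pmf_map_inj') (simp add: inj_def)
    then show "pmf (map_pmf uminus (dlap p)) i = pmf (dlap p) i" by (simp add: pmf)
  qed
  \<comment> \<open>The jumps determine \<open>F\<close> only up to an additive constant; this
    relation fixes the constant.\<close>
  have F01: "F 0 + F 1 = 1"
  proof -
    have "measure ?D {..<1} = measure (measure_pmf (map_pmf uminus (dlap p))) {..<1}" by (simp only: sym)
    also have "\<dots> = measure ?D (UNIV - {..<0})"
      by (subst measure_map_pmf, rule arg_cong[where f="measure ?D"], auto)
    also have "\<dots> = 1 - measure ?D {..<0}"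
      using measure_pmf.prob_compl[of "{..<0}" "dlap p"] by simp
    finally show ?thesis by (simp add: F_def pmf algebra_simps)
  qed
  have F1: "F 0 = 0" "F 1 = 1" using step[of 0] F01 by auto
  have Fpos: "F (1 + int n) = 1" for n
    by (induction n) (use F1 step[of "1 + int _"] in \<open>auto simp: algebra_simps\<close>)
  have Fneg: "F (- int n) = 0" for n
  proof (induction n)
    case (Suc n)
    then show ?case using step[of "- int (Suc n)"] by simp
  qed (simp add: F1)
  have F: "F j = of_bool (j > 0)" for j
    using Fpos[of "nat (j - 1)"] Fneg[of "nat (- j)"] by (cases "j > 0") auto
  let ?j = "lam - k"
  \<comment> \<open>This is the origin of \<open>F\<close>: the expectation of the first indicator
    is a distribution function, and the two atoms give the difference of point masses.\<close>
  have "h p lam (k + y) = indicator {..<?j} y + a * (indicator {?j - 1} y - indicator {?j} y)" for y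
    by (auto simp: h_def a_def indicator_def)
  then have "measure_pmf.expectation (dlap p) (\<lambda>y. h p lam (k + y)) = F ?j"
    by (simp add: F_def measure_pmf_single measure_pmf.emeasure_eq_measure)
  then show ?thesis by (simp add: F)
qed

text \<open>\<open>1 + p / (1 - p)^2\<close> is the largest absolute value of \<open>h\<close>. Over
  the common denominator its bound amounts to \<open>p^2 \<le> p\<close>.\<close>

lemma h_jump_bounds:
  fixes p :: real
  assumes p: "0 < p" "p < 1"
  shows "0 \<le> p / (1 - p)\<^sup>2" "1 + p / (1 - p)\<^sup>2 \<le> 1 / (1 - p)\<^sup>2"
proof -
  have "(1 - p)\<^sup>2 + p \<le> 1"
    using p mult_left_mono[of p 1 p] by (simp add: power2_eq_square algebra_simps)
  moreover have "1 + p / (1 - p)\<^sup>2 = ((1 - p)\<^sup>2 + p) / (1 - p)\<^sup>2"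
    using p by (simp add: add_divide_distrib)
  ultimately show "1 + p / (1 - p)\<^sup>2 \<le> 1 / (1 - p)\<^sup>2" using p by (simp add: divide_right_mono)
  show "0 \<le> p / (1 - p)\<^sup>2" using p by simp
qed

text \<open>The square of \<open>h\<close> is at most 1 except at two points, where it is at most
  \<open>1 / (1 - p)^4\<close>. Each of these has mass at most \<open>1 - p\<close> under the noise,
  which saves one power over the worst case.\<close>

lemma expectation_h_dlap_square_le:
  assumes p: "0 < p" "p < 1"
  shows "measure_pmf.expectation (dlap p) (\<lambda>y. (h p lam (k + y))\<^sup>2) \<le> 3 / (1 - p) ^ 3"
proof -
  define a where "a = p / (1 - p)\<^sup>2"
  let ?j = "lam - k"
  have a: "0 \<le> a" "1 + a \<le> 1 / (1 - p)\<^sup>2" using h_jump_bounds[OF p] by (simp_all add: a_def)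
  have h: "(h p lam (k + y))\<^sup>2 \<le> 1 + (1 + a)\<^sup>2 * (indicator {?j - 1} y + indicator {?j} y)" for y
  proof -
    have "a\<^sup>2 \<le> (1 + a)\<^sup>2" using a by (intro power_mono) auto
    then show ?thesis by (auto simp: h_def a_def[symmetric] indicator_def)
  qed
  have "measure_pmf.expectation (dlap p) (\<lambda>y. (h p lam (k + y))\<^sup>2)
     \<le> measure_pmf.expectation (dlap p) (\<lambda>y. 1 + (1 + a)\<^sup>2 * (indicator {?j - 1} y + indicator {?j} y))"
  proof (rule integral_mono[OF _ _ h])
    show "integrable (dlap p) (\<lambda>y. (h p lam (k + y))\<^sup>2)"
      by (rule measure_pmf.integrable_const_bound[where B="1 + (1 + a)\<^sup>2 * 2"])
        (auto intro!: order_trans[OF h] simp: indicator_def)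
  qed (simp add: measure_pmf.emeasure_eq_measure)
  also have "\<dots> = 1 + (1 + a)\<^sup>2 * (pmf (dlap p) (?j - 1) + pmf (dlap p) ?j)"
    by (simp add: measure_pmf_single measure_pmf.emeasure_eq_measure)
  also have "\<dots> \<le> 1 + (1 / (1 - p)\<^sup>2)\<^sup>2 * ((1 - p) + (1 - p))"
  proof -
    have "pmf (dlap p) i \<le> 1 - p" for i
    proof -
      have "(1 - p) / (1 + p) * p ^ nat \<bar>i\<bar> \<le> (1 - p) * 1"
        using p by (intro mult_mono power_le_one) (auto simp: field_simps)
      then show ?thesis by (simp add: pmf_dlap p)
    qed
    then show ?thesis using a by (intro add_left_mono mult_mono power_mono add_mono) auto
  qed
  also have "\<dots> = 1 + 2 / (1 - p) ^ 3"
  proof -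
    have "(1 / q\<^sup>2)\<^sup>2 * (q + q) = 2 / q ^ 3" if "q > 0" for q :: real
      using that by (simp add: field_simps eval_nat_numeral)
    from this[of "1 - p"] p show ?thesis by simp
  qed
  also have "\<dots> \<le> 3 / (1 - p) ^ 3"
  proof -
    have "(1 - p) ^ 3 \<le> 1" using p by (intro power_le_one) auto
    then show ?thesis using p by (simp add: field_simps)
  qed
  finally show ?thesis .
qed

section \<open>Triangles grouped by the edge opposite to the assigned vertex\<close>

text \<open>The orientation from the smaller endpoint selects, for each edge, the one copy of its
  noise that \<open>noisy_weight\<close> uses.\<close>

definition ordered_edges :: "nat set set \<Rightarrow> (nat \<times> nat) set" where
  "ordered_edges E = {(u, x). u < x \<and> {u, x} \<in> E}"

text \<open>The triangles that share the noise of one edge, each represented by its assigned vertex.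
  The size of this group is l(e).\<close>

definition apexes :: "nat set set \<Rightarrow> (nat set \<Rightarrow> nat) \<Rightarrow> nat \<times> nat \<Rightarrow> nat set" where
  "apexes E \<rho> = (\<lambda>(u, x). {v. {v, u, x} \<in> triangles E \<and> \<rho> {v, u, x} = v})"

section \<open>Counting edges and triangles\<close>

text \<open>Membership in \<open>triangles\<close> provides only some enumeration of the vertex set.
  Cardinality 3 makes any other enumeration by three vertices distinct, and then all its pairs are
  edges.\<close>

lemma triangle_iff:
  "{v, u, x} \<in> triangles E \<longleftrightarrow>
    {v, u} \<in> E \<and> {v, x} \<in> E \<and> {u, x} \<in> E \<and> v \<noteq> u \<and> v \<noteq> x \<and> u \<noteq> x"
proof
  assume "{v, u, x} \<in> triangles E"
  then obtain a b c where T: "{v, u, x} = {a, b, c}" and E: "{a, b} \<in> E" "{b, c} \<in> E" "{a, c} \<in> E"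
    and ne: "a \<noteq> b" "b \<noteq> c" "a \<noteq> c"
    unfolding triangles_def by blast
  have "card {v, u, x} = 3" using ne by (simp add: T)
  then have "v \<noteq> u \<and> v \<noteq> x \<and> u \<noteq> x" by (auto simp: card_insert_if split: if_splits)
  moreover have "{y, z} \<in> E" if "y \<in> {a, b, c}" "z \<in> {a, b, c}" "y \<noteq> z" for y z
    using that E by (auto simp: insert_commute)
  ultimately show "{v, u} \<in> E \<and> {v, x} \<in> E \<and> {u, x} \<in> E \<and> v \<noteq> u \<and> v \<noteq> x \<and> u \<noteq> x"
    unfolding T[symmetric] by blast
next
  assume "{v, u} \<in> E \<and> {v, x} \<in> E \<and> {u, x} \<in> E \<and> v \<noteq> u \<and> v \<noteq> x \<and> u \<noteq> x"
  then show "{v, u, x} \<in> triangles E" unfolding triangles_def by blast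
qed

lemma simple_graph_edge:
  assumes "simple_graph n E" "{u, v} \<in> E"
  shows "u \<in> {1..n}" "v \<in> {1..n}" "u \<noteq> v"
  using assms unfolding simple_graph_def by (auto simp: doubleton_eq_iff dest!: subsetD)

lemma finite_nbhd: "simple_graph n E \<Longrightarrow> finite (nbhd E v)"
  by (rule finite_subset[of _ "{1..n}"]) (auto simp: nbhd_def dest: simple_graph_edge)

lemma finite_arcs: "simple_graph n E \<Longrightarrow> finite (arcs E)"
  by (rule finite_subset[of _ "{1..n} \<times> {1..n}"]) (auto simp: arcs_def dest: simple_graph_edge)

lemma ordered_edges_subset: "ordered_edges E \<subseteq> arcs E"
  by (auto simp: ordered_edges_def arcs_def)

lemma bij_betw_ordered_edges:
  assumes "simple_graph n E"
  shows "bij_betw (\<lambda>(u, x). {u, x}) (ordered_edges E) E"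
  unfolding bij_betw_def
proof
  show "inj_on (\<lambda>(u, x). {u, x}) (ordered_edges E)"
    by (auto simp: inj_on_def ordered_edges_def doubleton_eq_iff)
  show "(\<lambda>(u, x). {u, x}) ` ordered_edges E = E"
  proof
    show "E \<subseteq> (\<lambda>(u, x). {u, x}) ` ordered_edges E"
    proof
      fix e assume e: "e \<in> E"
      with assms obtain u v where uv: "e = {u, v}" "u \<noteq> v"
        unfolding simple_graph_def by blast
      have "(min u v, max u v) \<in> ordered_edges E" "e = {min u v, max u v}"
        using e uv by (auto simp: ordered_edges_def min_def max_def insert_commute)
      then show "e \<in> (\<lambda>(u, x). {u, x}) ` ordered_edges E" by (force simp: image_iff)
    qed
  qed (auto simp: ordered_edges_def)
qed

text \<open>One half of the handshake lemma: every pair of a vertex and a neighbour is an ordered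
  edge or the reversal of one.\<close>

lemma degree_sum_le:
  assumes G: "simple_graph n E"
  shows "(\<Sum>v=1..n. card (nbhd E v)) \<le> 2 * card E"
proof -
  let ?P = "ordered_edges E"
  have fin: "finite ?P" using finite_subset[OF ordered_edges_subset finite_arcs[OF G]] .
  have "(\<Sum>v=1..n. card (nbhd E v)) = card (Sigma {1..n} (nbhd E))"
    using finite_nbhd[OF G] by simp
  also have "Sigma {1..n} (nbhd E) \<subseteq> ?P \<union> prod.swap ` ?P"
  proof (clarify)
    fix v u assume "u \<in> nbhd E v" "(v, u) \<notin> prod.swap ` ?P"
    then have "{v, u} \<in> E" "(u, v) \<notin> ?P" by (auto simp: nbhd_def)
    moreover from this have "v \<noteq> u" using simple_graph_edge[OF G] by blast
    ultimately show "(v, u) \<in> ?P" by (auto simp: ordered_edges_def insert_commute)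
  qed
  then have "card (Sigma {1..n} (nbhd E)) \<le> card (?P \<union> prod.swap ` ?P)"
    using fin by (intro card_mono) auto
  also have "\<dots> \<le> card ?P + card (prod.swap ` ?P)" by (rule card_Un_le)
  also have "card (prod.swap ` ?P) = card ?P" by (intro card_image) auto
  also have "card ?P = card E" by (rule bij_betw_same_card[OF bij_betw_ordered_edges[OF G]])
  finally show ?thesis by simp
qed

lemma sum_degree_square_le:
  assumes G: "simple_graph n E"
  shows "(\<Sum>v=1..n. (real (card (nbhd E v)))\<^sup>2) \<le> 2 * real (max_degree n E) * real (card E)"
proof -
  have "(\<Sum>v=1..n. (real (card (nbhd E v)))\<^sup>2)
      \<le> (\<Sum>v=1..n. real (max_degree n E) * real (card (nbhd E v)))"
    unfolding power2_eq_square max_degree_def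
    by (intro sum_mono mult_right_mono) auto
  also have "\<dots> = real (max_degree n E) * real (\<Sum>v=1..n. card (nbhd E v))"
    by (simp add: sum_distrib_left)
  also have "\<dots> \<le> real (max_degree n E) * real (2 * card E)"
    using degree_sum_le[OF G] by (intro mult_left_mono of_nat_mono) auto
  finally show ?thesis by (simp add: mult_ac)
qed

lemma apexes_subset: "simple_graph n E \<Longrightarrow> apexes E \<rho> e \<subseteq> {1..n}"
  by (auto simp: apexes_def triangle_iff split: prod.splits dest: simple_graph_edge)

lemma finite_apexes: "simple_graph n E \<Longrightarrow> finite (apexes E \<rho> e)"
  by (rule finite_subset[OF apexes_subset]) auto

text \<open>The map from \<open>v\<close> to \<open>{v, u, x}\<close> has \<rho> as a left inverse,
  and its image consists of the triangles counted by l(e).\<close>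

lemma card_apexes:
  assumes \<rho>: "\<forall>T\<in>triangles E. \<rho> T \<in> T" and ux: "u \<noteq> x"
  shows "card (apexes E \<rho> (u, x)) = opp_count E \<rho> {u, x}"
  unfolding opp_count_def
proof (rule bij_betw_same_card[of "\<lambda>v. {v, u, x}"], unfold bij_betw_def, intro conjI)
  show "inj_on (\<lambda>v. {v, u, x}) (apexes E \<rho> (u, x))"
    by (rule inj_on_inverseI[where g=\<rho>]) (auto simp: apexes_def)
  show "(\<lambda>v. {v, u, x}) ` apexes E \<rho> (u, x) = {T \<in> triangles E. {u, x} \<subseteq> T \<and> \<rho> T \<notin> {u, x}}"
    (is "?L = ?R")
  proof
    show "?L \<subseteq> ?R"
    proof
      fix T assume "T \<in> ?L"
      then obtain v where v: "T = {v, u, x}" "T \<in> triangles E" "\<rho> T = v" by (auto simp: apexes_def)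
      then show "T \<in> ?R" using triangle_iff[of v u x E] by auto
    qed
    show "?R \<subseteq> ?L"
    proof
      fix T assume T: "T \<in> ?R"
      then obtain a b c where abc: "T = {a, b, c}" by (auto simp: triangles_def)
      have "u \<noteq> x" using ux by simp
      have "\<rho> T \<in> T" using \<rho> T by blast
      \<comment> \<open>The distinct vertices \<open>u\<close> and \<open>x\<close> together with
        \<open>\<rho> T\<close>, which differs from both, exhaust a set of at most three
        elements.\<close>
      with T abc \<open>u \<noteq> x\<close> have "T = {\<rho> T, u, x}" by auto
      then obtain v where "T = {v, u, x}" "\<rho> T = v" by blast
      with T show "T \<in> ?L" by (auto simp: apexes_def)
    qed
  qed
qed

text \<open>A triangle determines its assigned vertex; removing that vertex leaves the opposite
  edge, whose orientation is forced by the order. Sums over triangles can thus be grouped by shared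
  noise.\<close>

lemma bij_betw_triangles:
  assumes \<rho>: "\<forall>T\<in>triangles E. \<rho> T \<in> T"
  shows "bij_betw (\<lambda>(e, v). {v, fst e, snd e}) (Sigma (ordered_edges E) (apexes E \<rho>)) (triangles E)"
  unfolding bij_betw_def
proof
  show "inj_on (\<lambda>(e, v). {v, fst e, snd e}) (Sigma (ordered_edges E) (apexes E \<rho>))"
  proof (rule inj_onI, safe)
    fix u x v u' x' v'
    assume uv: "(u, x) \<in> ordered_edges E" "v \<in> apexes E \<rho> (u, x)"
      and uv': "(u', x') \<in> ordered_edges E" "v' \<in> apexes E \<rho> (u', x')"
      and "{v, fst (u, x), snd (u, x)} = {v', fst (u', x'), snd (u', x')}"
    then have eq: "{v, u, x} = {v', u', x'}" by simp
    have \<rho>v: "\<rho> {v, u, x} = v" "\<rho> {v', u', x'} = v'" using uv(2) uv'(2) by (simp_all add: apexes_def)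
    then show v: "v = v'" using eq by simp
    have "{u, x} = {v, u, x} - {v}" using uv(2) by (auto simp: apexes_def triangle_iff)
    also have "\<dots> = {v', u', x'} - {v'}" unfolding eq unfolding v ..
    also have "\<dots> = {u', x'}" using uv'(2) by (auto simp: apexes_def triangle_iff)
    finally have "{u, x} = {u', x'}" .
    moreover have "u < x" "u' < x'" using uv(1) uv'(1) by (simp_all add: ordered_edges_def)
    ultimately show "u = u'" "x = x'" by (auto simp: doubleton_eq_iff)
  qed
  show "(\<lambda>(e, v). {v, fst e, snd e}) ` Sigma (ordered_edges E) (apexes E \<rho>) = triangles E"
  proof
    show "triangles E \<subseteq> (\<lambda>(e, v). {v, fst e, snd e}) ` Sigma (ordered_edges E) (apexes E \<rho>)"
    proof
      fix T assume T: "T \<in> triangles E"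
      define v where "v = \<rho> T"
      have v: "\<rho> T = v" "v \<in> T" using \<rho>[rule_format, OF T] by (simp_all add: v_def)
      from T obtain a b c where "T = {a, b, c}" unfolding triangles_def by blast
      with v(2) obtain u x where ux: "T = {v, u, x}" by blast
      let ?u = "min u x" and ?x = "max u x"
      have T': "T = {v, ?u, ?x}" using ux by (auto simp: min_def max_def)
      have "{v, u, x} \<in> triangles E" using T ux by simp
      then have "(?u, ?x) \<in> ordered_edges E"
        by (auto simp: triangle_iff ordered_edges_def min_def max_def insert_commute)
      moreover have "v \<in> apexes E \<rho> (?u, ?x)"
        using T v(1) unfolding T' by (simp add: apexes_def)
      ultimately show "T \<in> (\<lambda>(e, v). {v, fst e, snd e}) ` Sigma (ordered_edges E) (apexes E \<rho>)"
        using T' by (intro image_eqI[of _ _ "((?u, ?x), v)"] SigmaI) simp_all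
    qed
  qed (auto simp: apexes_def)
qed

text \<open>\<open>triangle_weight\<close> runs over increasing pairs, so the six orders of the
  vertices are compared. Symmetry of \<open>w\<close> is available on edges, which the triangle
  supplies.\<close>

lemma triangle_weight_eq:
  assumes "\<forall>u v. {u, v} \<in> E \<longrightarrow> w u v = w v u" "{v, u, x} \<in> triangles E"
  shows "triangle_weight w {v, u, x} = w v u + w v x + w u x"
proof -
  have *: "triangle_weight w {a, b, c} = w a b + w a c + w b c" if "a < b" "b < c" for a b c
  proof -
    have "{(u, v). u \<in> {a, b, c} \<and> v \<in> {a, b, c} \<and> u < v} = {(a, b), (a, c), (b, c)}"
      using that by auto
    then show ?thesis using that by (simp add: triangle_weight_def)
  qed
  have "v \<noteq> u" "v \<noteq> x" "u \<noteq> x" and sym: "w u v = w v u" "w x v = w v x" "w x u = w u x"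
    using assms(1)[rule_format, of u v] assms(1)[rule_format, of x v]
      assms(1)[rule_format, of x u] assms(2) by (auto simp: triangle_iff insert_commute)
  then consider "v < u" "u < x" | "v < x" "x < u" | "u < v" "v < x" | "u < x" "x < v"
    | "x < v" "v < u" | "x < u" "u < v"
    by linarith
  then show ?thesis
  proof cases
    case 1
    then show ?thesis using * by simp
  next
    case 2
    moreover have "{v, u, x} = {v, x, u}" by auto
    ultimately show ?thesis using *[of v x u] sym by simp
  next
    case 3
    moreover have "{v, u, x} = {u, v, x}" by auto
    ultimately show ?thesis using *[of u v x] sym by simp
  next
    case 4
    moreover have "{v, u, x} = {u, x, v}" by auto
    ultimately show ?thesis using *[of u x v] sym by simp
  next
    case 5
    moreover have "{v, u, x} = {x, v, u}" by auto
    ultimately show ?thesis using *[of x v u] sym by simp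
  next
    case 6
    moreover have "{v, u, x} = {x, u, v}" by auto
    ultimately show ?thesis using *[of x u v] sym by simp
  qed
qed

text \<open>The sums over nodes and opposite edges are interchanged. Since \<open>u < x\<close>, the
  noisy weight is \<open>w u x + Y (u, x)\<close>, so the inner sum depends on the noise only
  through \<open>Y e\<close>.\<close>

lemma sum_local_est:
  assumes G: "simple_graph n E"
  shows "(\<Sum>v=1..n. local_est p lam E \<rho> (noisy_weight w Y) v (w v))
    = (\<Sum>e\<in>ordered_edges E. \<Sum>v\<in>apexes E \<rho> e.
        h p lam (w v (fst e) + w v (snd e) + w (fst e) (snd e) + Y e))"
proof -
  let ?I = "\<lambda>v. {(u, x). u < x \<and> {v, u, x} \<in> triangles E \<and> \<rho> {v, u, x} = v}"
  have fP: "finite (ordered_edges E)" using finite_subset[OF ordered_edges_subset finite_arcs[OF G]] .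
  have fI: "finite (?I v)" for v
    by (rule finite_subset[OF _ fP]) (auto simp: ordered_edges_def triangle_iff)
  have "(\<Sum>v=1..n. local_est p lam E \<rho> (noisy_weight w Y) v (w v))
    = (\<Sum>v=1..n. \<Sum>e\<in>?I v. h p lam (w v (fst e) + w v (snd e) + w (fst e) (snd e) + Y e))"
    unfolding local_est_def by (intro sum.cong refl) (auto simp: noisy_weight_def add_ac)
  also have "\<dots> = (\<Sum>(v, e)\<in>Sigma {1..n} ?I. h p lam (w v (fst e) + w v (snd e) + w (fst e) (snd e) + Y e))"
    using fI by (subst sum.Sigma) auto
  also have "\<dots> = (\<Sum>(e, v)\<in>Sigma (ordered_edges E) (apexes E \<rho>).
      h p lam (w v (fst e) + w v (snd e) + w (fst e) (snd e) + Y e))"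
  proof (rule sum.reindex_bij_witness[of _ prod.swap prod.swap])
    fix a assume "a \<in> Sigma (ordered_edges E) (apexes E \<rho>)"
    then show "prod.swap a \<in> Sigma {1..n} ?I"
      using subsetD[OF apexes_subset[OF G]] by (force simp: ordered_edges_def apexes_def)
  qed (auto simp: ordered_edges_def apexes_def triangle_iff)
  also have "\<dots> = (\<Sum>e\<in>ordered_edges E. \<Sum>v\<in>apexes E \<rho> e.
        h p lam (w v (fst e) + w v (snd e) + w (fst e) (snd e) + Y e))"
    using fP finite_apexes[OF G] by (subst sum.Sigma) auto
  finally show ?thesis .
qed

lemma finite_triangles:
  assumes "simple_graph n E"
  shows "finite (triangles E)"
proof (rule finite_subset)
  show "triangles E \<subseteq> Pow {1..n}"
    using simple_graph_edge(1,2)[OF assms] unfolding triangles_def by blast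
qed simp

text \<open>The true count is indexed like the estimator, so that the Step 1 error can be formed
  term by term.\<close>

lemma below_count_eq:
  assumes G: "simple_graph n E" and w: "\<forall>u v. {u, v} \<in> E \<longrightarrow> w u v = w v u"
    and \<rho>: "\<forall>T\<in>triangles E. \<rho> T \<in> T"
  shows "real (below_count E w lam)
    = (\<Sum>e\<in>ordered_edges E. \<Sum>v\<in>apexes E \<rho> e.
        of_bool (w v (fst e) + w v (snd e) + w (fst e) (snd e) < lam))"
proof -
  have fP: "finite (ordered_edges E)" using finite_subset[OF ordered_edges_subset finite_arcs[OF G]] .
  have "real (below_count E w lam) = (\<Sum>T\<in>triangles E. of_bool (triangle_weight w T < lam))"
    using finite_triangles[OF G] by (simp add: below_count_def of_bool_def sum.If_cases Collect_conj_eq)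
  also have "\<dots> = (\<Sum>(e, v)\<in>Sigma (ordered_edges E) (apexes E \<rho>). of_bool (triangle_weight w {v, fst e, snd e} < lam))"
    by (subst sum.reindex_bij_betw[OF bij_betw_triangles[OF \<rho>], symmetric]) (simp add: case_prod_beta)
  also have "\<dots> = (\<Sum>(e, v)\<in>Sigma (ordered_edges E) (apexes E \<rho>).
     of_bool (w v (fst e) + w v (snd e) + w (fst e) (snd e) < lam))"
    by (intro sum.cong refl) (auto simp: apexes_def triangle_weight_eq[OF w])
  also have "\<dots> = (\<Sum>e\<in>ordered_edges E. \<Sum>v\<in>apexes E \<rho> e.
        of_bool (w v (fst e) + w v (snd e) + w (fst e) (snd e) < lam))"
    using fP finite_apexes[OF G] by (subst sum.Sigma) auto
  finally show ?thesis .
qed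

text \<open>In \<open>l^2 = l + 2 * (l choose 2)\<close> the group sizes add up to the number of
  triangles and the binomials to \<open>c4_count\<close>.\<close>

lemma sum_card_apexes_square:
  assumes G: "simple_graph n E" and \<rho>: "\<forall>T\<in>triangles E. \<rho> T \<in> T"
  shows "(\<Sum>e\<in>ordered_edges E. (real (card (apexes E \<rho> e)))\<^sup>2)
    = real (card (triangles E)) + 2 * real (c4_count E \<rho>)"
proof -
  have fP: "finite (ordered_edges E)" using finite_subset[OF ordered_edges_subset finite_arcs[OF G]] .
  have sq: "(real k)\<^sup>2 = real k + 2 * real (k choose 2)" for k
    by (induction k) (auto simp: numeral_2_eq_2 algebra_simps)
  have "card (triangles E) = card (Sigma (ordered_edges E) (apexes E \<rho>))"
    using bij_betw_same_card[OF bij_betw_triangles[OF \<rho>]] by simp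
  also have "\<dots> = (\<Sum>e\<in>ordered_edges E. card (apexes E \<rho> e))"
    using finite_apexes[OF G] by (simp add: fP)
  finally have 1: "card (triangles E) = (\<Sum>e\<in>ordered_edges E. card (apexes E \<rho> e))" .
  have 2: "c4_count E \<rho> = (\<Sum>e\<in>ordered_edges E. card (apexes E \<rho> e) choose 2)"
    unfolding c4_count_def
    by (subst sum.reindex_bij_betw[OF bij_betw_ordered_edges[OF G], symmetric])
      (auto intro!: sum.cong simp: card_apexes[OF \<rho>] ordered_edges_def)
  show ?thesis unfolding sq sum.distrib 1 2 by (simp add: sum_distrib_left)
qed

section \<open>Sensitivity of the local queries\<close>

lemma global_sens_local_est:
  assumes G: "simple_graph n E" and p: "0 < p" "p < 1"
  shows "0 \<le> global_sens (nbhd E v) (local_est p lam E \<rho> w' v)"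
    and "global_sens (nbhd E v) (local_est p lam E \<rho> w' v) \<le> 2 / (1 - p)\<^sup>2 * real (card (nbhd E v))"
proof -
  let ?N = "nbhd E v" and ?F = "local_est p lam E \<rho> w' v"
  let ?A = "{\<bar>?F a - ?F b\<bar> | a b. (\<Sum>u\<in>?N. \<bar>a u - b u\<bar>) \<le> 1}"
  have fin: "finite ?A" by (rule finite_sens_set[OF finite_range_local_est[OF G]])
  have "0 \<in> ?A" by (auto intro!: exI[of _ "\<lambda>_. 0"])
  then show "0 \<le> global_sens ?N ?F" unfolding global_sens_def using fin by (rule Max_ge[rotated])
  define K where "K = 2 / (1 - p)\<^sup>2"
  have K: "0 \<le> K" "\<bar>h p lam i - h p lam j\<bar> \<le> K" for i j
  proof -
    show "0 \<le> K" by (simp add: K_def)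
    define a where "a = p / (1 - p)\<^sup>2"
    have a: "0 \<le> a" "1 + a \<le> 1 / (1 - p)\<^sup>2" using h_jump_bounds[OF p] by (simp_all add: a_def)
    \<comment> \<open>The extreme values of \<open>h\<close> are \<open>- a\<close> and
      \<open>1 + a\<close>; their distance is below \<open>2 * (1 + a)\<close>, the source of the 2
      in \<open>K\<close>.\<close>
    have "\<bar>h p lam i - h p lam j\<bar> \<le> 1 + 2 * a"
      using a by (auto simp: h_def a_def[symmetric])
    then show "\<bar>h p lam i - h p lam j\<bar> \<le> K" using a by (simp add: K_def)
  qed
  have le: "\<bar>?F a - ?F b\<bar> \<le> K * card ?N" if ab: "(\<Sum>u\<in>?N. \<bar>a u - b u\<bar>) \<le> 1" for a b
  proof -
    let ?I = "{(u, x). u < x \<and> {v, u, x} \<in> triangles E \<and> \<rho> {v, u, x} = v}"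
    define \<delta> where "\<delta> u = real_of_int \<bar>a u - b u\<bar>" for u
    have fN: "finite ?N" by (rule finite_nbhd[OF G])
    have IN: "?I \<subseteq> ?N \<times> ?N" "prod.swap ` ?I \<subseteq> ?N \<times> ?N" by (auto simp: nbhd_def triangle_iff)
    have fI: "finite ?I" using IN(1) fN by (meson finite_SigmaI finite_subset)
    have "\<bar>?F a - ?F b\<bar> \<le> (\<Sum>(u, x)\<in>?I. \<bar>h p lam (a u + a x + w' u x) - h p lam (b u + b x + w' u x)\<bar>)"
      unfolding local_est_def sum_subtractf[symmetric] by (rule order_trans[OF sum_abs]) (simp add: case_prod_beta)
    \<comment> \<open>The arguments are integers, so \<open>\<delta> u + \<delta> x\<close> is at least 1 unless it vanishes.\<close>
    also have "\<dots> \<le> (\<Sum>(u, x)\<in>?I. K * (\<delta> u + \<delta> x))"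
    proof (rule sum_mono, clarify)
      fix u x
      show "\<bar>h p lam (a u + a x + w' u x) - h p lam (b u + b x + w' u x)\<bar> \<le> K * (\<delta> u + \<delta> x)"
      proof (cases "a u = b u \<and> a x = b x")
        case False
        then have "1 \<le> \<delta> u + \<delta> x" by (auto simp: \<delta>_def)
        then have "K * 1 \<le> K * (\<delta> u + \<delta> x)" by (intro mult_left_mono K)
        then show ?thesis by (intro order_trans[OF K(2)]) simp
      qed (simp add: \<delta>_def K)
    qed
    also have "\<dots> = K * ((\<Sum>(u, x)\<in>?I. \<delta> u) + (\<Sum>(u, x)\<in>?I. \<delta> x))"
      unfolding case_prod_beta sum.distrib[symmetric] sum_distrib_left ..
    \<comment> \<open>Pairs in \<open>?I\<close> are increasing, so \<open>?I\<close> and its swap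
      are disjoint subsets of \<open>?N \<times> ?N\<close>. Together they count each
      \<open>\<delta> u\<close> at most \<open>card ?N\<close> times, without an additional factor
      2.\<close>
    also have "(\<Sum>(u, x)\<in>?I. \<delta> x) = (\<Sum>(u, x)\<in>prod.swap ` ?I. \<delta> u)"
      by (subst sum.reindex) (auto simp: case_prod_beta)
    also have "(\<Sum>(u, x)\<in>?I. \<delta> u) + (\<Sum>(u, x)\<in>prod.swap ` ?I. \<delta> u) = (\<Sum>(u, x)\<in>?I \<union> prod.swap ` ?I. \<delta> u)"
      using fI by (subst sum.union_disjoint) auto
    also have "\<dots> \<le> (\<Sum>(u, x)\<in>?N \<times> ?N. \<delta> u)"
      using IN fN by (intro sum_mono2) (auto simp: \<delta>_def)
    also have "\<dots> = card ?N * (\<Sum>u\<in>?N. \<delta> u)"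
      by (simp add: sum.cartesian_product[symmetric] sum_distrib_left)
    also have "(\<Sum>u\<in>?N. \<delta> u) = real_of_int (\<Sum>u\<in>?N. \<bar>a u - b u\<bar>)" by (simp add: \<delta>_def)
    also have "\<dots> \<le> real_of_int 1" using ab by (simp only: of_int_le_iff)
    finally show ?thesis using K by (simp add: mult_left_mono)
  qed
  show "global_sens ?N ?F \<le> 2 / (1 - p)\<^sup>2 * real (card ?N)"
    unfolding global_sens_def K_def[symmetric] using fin \<open>0 \<in> ?A\<close> le by (subst Max_le_iff) auto
qed

section \<open>Mean squared error\<close>

text \<open>The Step 1 error of a whole group of triangles, as a function of the single noise value
  \<open>y\<close> that they share.\<close>

definition edge_error ::
  "real \<Rightarrow> int \<Rightarrow> nat set set \<Rightarrow> (nat \<Rightarrow> nat \<Rightarrow> int) \<Rightarrow> (nat set \<Rightarrow> nat) \<Rightarrow> nat \<times> nat \<Rightarrow> int \<Rightarrow> real" where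
  "edge_error p lam E w \<rho> e y = (\<Sum>v\<in>apexes E \<rho> e.
     h p lam (w v (fst e) + w v (snd e) + w (fst e) (snd e) + y)
     - of_bool (w v (fst e) + w v (snd e) + w (fst e) (snd e) < lam))"

text \<open>\<open>h\<close> takes at most four values, so every function of it is bounded.\<close>

lemma integrable_h_pmf:
  fixes D :: "int pmf"
  shows "integrable D (\<lambda>y. h p lam (k + y))" "integrable D (\<lambda>y. (h p lam (k + y) - c)\<^sup>2)"
proof -
  have fin: "finite (range (h p lam))"
    by (rule finite_subset[of _ "{0, - (p / (1 - p)\<^sup>2), 1 + p / (1 - p)\<^sup>2, 1}"]) (auto simp: h_def)
  have "integrable D (\<lambda>y. g (h p lam (k + y)))" for g :: "real \<Rightarrow> real"
  proof (rule measure_pmf.integrable_const_bound)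
    show "AE y in D. norm (g (h p lam (k + y))) \<le> Max ((\<lambda>x. \<bar>g x\<bar>) ` range (h p lam))"
      using fin by (intro AE_I2) (auto intro!: Max_ge)
  qed simp
  from this[of "\<lambda>x. x"] this[of "\<lambda>x. (x - c)\<^sup>2"]
  show "integrable D (\<lambda>y. h p lam (k + y))" "integrable D (\<lambda>y. (h p lam (k + y) - c)\<^sup>2)"
    by simp_all
qed

text \<open>The summands share one noise value and need not be independent, hence Cauchy-Schwarz and
  the squared group size. The variance of a summand is bounded by its second moment.\<close>

lemma edge_error_moments:
  assumes p: "0 < p" "p < 1"
  shows "measure_pmf.expectation (dlap p) (edge_error p lam E w \<rho> e) = 0"
    and "integrable (dlap p) (\<lambda>y. (edge_error p lam E w \<rho> e y)\<^sup>2)"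
    and "measure_pmf.expectation (dlap p) (\<lambda>y. (edge_error p lam E w \<rho> e y)\<^sup>2)
      \<le> 3 / (1 - p) ^ 3 * (real (card (apexes E \<rho> e)))\<^sup>2"
proof -
  let ?V = "apexes E \<rho> e" and ?D = "measure_pmf (dlap p)"
  define k where "k v = w v (fst e) + w v (snd e) + w (fst e) (snd e)" for v
  define g where "g v = (of_bool (k v < lam) :: real)" for v
  have err: "edge_error p lam E w \<rho> e = (\<lambda>y. \<Sum>v\<in>?V. h p lam (k v + y) - g v)"
    by (simp add: edge_error_def k_def g_def fun_eq_iff)
  have mean: "measure_pmf.expectation (dlap p) (\<lambda>y. h p lam (k v + y)) = g v" for v
    by (simp add: g_def expectation_h_dlap[OF p])
  show "measure_pmf.expectation (dlap p) (edge_error p lam E w \<rho> e) = 0"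
    unfolding err by (simp add: integrable_h_pmf mean)
  have var: "measure_pmf.expectation (dlap p) (\<lambda>y. (h p lam (k v + y) - g v)\<^sup>2) \<le> 3 / (1 - p) ^ 3" for v
  proof -
    have "measure_pmf.variance (dlap p) (\<lambda>y. h p lam (k v + y))
        = measure_pmf.expectation (dlap p) (\<lambda>y. (h p lam (k v + y))\<^sup>2) - (g v)\<^sup>2"
      using integrable_h_pmf(2)[of "dlap p" p lam "k v" 0]
      by (subst measure_pmf.variance_eq) (auto simp: integrable_h_pmf(1) mean)
    also have "\<dots> \<le> 3 / (1 - p) ^ 3 - 0"
      by (intro diff_mono expectation_h_dlap_square_le p) simp
    finally show ?thesis by (simp add: mean)
  qed
  have cs: "(edge_error p lam E w \<rho> e y)\<^sup>2 \<le> real (card ?V) * (\<Sum>v\<in>?V. (h p lam (k v + y) - g v)\<^sup>2)" for y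
    unfolding err using sum_squared_le_sum_of_squares[of "\<lambda>v. h p lam (k v + y) - g v" ?V]
    by (simp add: mult.commute)
  have int: "integrable ?D (\<lambda>y. real (card ?V) * (\<Sum>v\<in>?V. (h p lam (k v + y) - g v)\<^sup>2))"
    by (intro integrable_mult_right Bochner_Integration.integrable_sum integrable_h_pmf)
  show int_sq: "integrable ?D (\<lambda>y. (edge_error p lam E w \<rho> e y)\<^sup>2)"
    by (rule Bochner_Integration.integrable_bound[OF int])
      (auto intro!: AE_I2 order_trans[OF cs])
  have "measure_pmf.expectation (dlap p) (\<lambda>y. (edge_error p lam E w \<rho> e y)\<^sup>2)
    \<le> measure_pmf.expectation (dlap p) (\<lambda>y. real (card ?V) * (\<Sum>v\<in>?V. (h p lam (k v + y) - g v)\<^sup>2))"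
    by (rule integral_mono[OF int_sq int cs])
  also have "\<dots> = real (card ?V) * (\<Sum>v\<in>?V. measure_pmf.expectation (dlap p) (\<lambda>y. (h p lam (k v + y) - g v)\<^sup>2))"
    by (simp add: integrable_h_pmf)
  also have "\<dots> \<le> real (card ?V) * (\<Sum>v\<in>?V. 3 / (1 - p) ^ 3)"
    by (intro mult_left_mono sum_mono var) simp
  also have "\<dots> = 3 / (1 - p) ^ 3 * (real (card ?V))\<^sup>2" by (simp add: power2_eq_square)
  finally show "measure_pmf.expectation (dlap p) (\<lambda>y. (edge_error p lam E w \<rho> e y)\<^sup>2)
      \<le> 3 / (1 - p) ^ 3 * (real (card ?V))\<^sup>2" .
qed

text \<open>Different ordered edges read different coordinates of \<open>Y\<close>, so the group
  errors are independent and centred and their second moments add up.\<close>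

lemma step_one_mse:
  fixes lam :: int
  assumes G: "simple_graph n E" and w: "\<forall>u v. {u, v} \<in> E \<longrightarrow> w u v = w v u"
    and \<rho>: "\<forall>T\<in>triangles E. \<rho> T \<in> T" and p: "0 < p" "p < 1"
  defines "D \<equiv> \<lambda>Y. (\<Sum>v=1..n. local_est p lam E \<rho> (noisy_weight w Y) v (w v)) - real (below_count E w lam)"
  shows "(\<integral>\<^sup>+Y. ennreal ((D Y)\<^sup>2) \<partial>Pi_pmf (arcs E) 0 (\<lambda>_. dlap p))
    \<le> ennreal (3 / (1 - p) ^ 3 * (real (card (triangles E)) + 2 * real (c4_count E \<rho>)))"
proof -
  let ?M = "Pi_pmf (arcs E) 0 (\<lambda>_. dlap p)" and ?P = "ordered_edges E"
  let ?X = "\<lambda>e. edge_error p lam E w \<rho> e"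
  have ps: "prob_space ?M" by (rule measure_pmf.prob_space_axioms)
  have fP: "finite ?P" using finite_subset[OF ordered_edges_subset finite_arcs[OF G]] .
  have D: "D Y = (\<Sum>e\<in>?P. ?X e (Y e))" for Y
    unfolding D_def sum_local_est[OF G] below_count_eq[OF G w \<rho>] edge_error_def sum_subtractf ..
  have comp: "map_pmf (\<lambda>Y. Y e) ?M = dlap p" if "e \<in> ?P" for e
    using that ordered_edges_subset finite_arcs[OF G] by (subst Pi_pmf_component) auto
  have "prob_space.indep_vars ?M (\<lambda>_. count_space UNIV) (\<lambda>e Y. Y e) ?P"
    by (rule prob_space.indep_vars_subset[OF ps indep_vars_Pi_pmf[OF finite_arcs[OF G]]
          ordered_edges_subset])
  then have ind: "prob_space.indep_vars ?M (\<lambda>_. borel) (\<lambda>e Y. ?X e (Y e)) ?P"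
    by (rule prob_space.indep_vars_compose2[OF ps]) auto
  have int: "integrable ?M (\<lambda>Y. (?X e (Y e))\<^sup>2)"
    and mean: "measure_pmf.expectation ?M (\<lambda>Y. ?X e (Y e)) = 0"
    and sq: "measure_pmf.expectation ?M (\<lambda>Y. (?X e (Y e))\<^sup>2)
      \<le> 3 / (1 - p) ^ 3 * (real (card (apexes E \<rho> e)))\<^sup>2" if "e \<in> ?P" for e
  proof -
    \<comment> \<open>Opaque, since \<open>dlap p\<close> occurs in \<open>?M\<close> and unfolding would loop.\<close>
    define N where "N = map_pmf (\<lambda>Y. Y e) ?M"
    have N: "dlap p = N" using comp[OF that] by (simp only: N_def)
    note mom = edge_error_moments[OF p, of lam E w \<rho> e, unfolded N]
    show "integrable ?M (\<lambda>Y. (?X e (Y e))\<^sup>2)" using mom(2) by (simp add: N_def)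
    show "measure_pmf.expectation ?M (\<lambda>Y. ?X e (Y e)) = 0" using mom(1) by (simp add: N_def)
    show "measure_pmf.expectation ?M (\<lambda>Y. (?X e (Y e))\<^sup>2)
      \<le> 3 / (1 - p) ^ 3 * (real (card (apexes E \<rho> e)))\<^sup>2" using mom(3) by (simp add: N_def)
  qed
  have "integrable ?M (\<lambda>Y. (D Y)\<^sup>2)" and
    "measure_pmf.expectation ?M (\<lambda>Y. (D Y)\<^sup>2) = (\<Sum>e\<in>?P. measure_pmf.expectation ?M (\<lambda>Y. (?X e (Y e))\<^sup>2))"
    using prob_space.bienayme[OF ps fP ind int mean, of 0] by (auto simp: D)
  moreover have "(\<Sum>e\<in>?P. measure_pmf.expectation ?M (\<lambda>Y. (?X e (Y e))\<^sup>2))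
      \<le> (\<Sum>e\<in>?P. 3 / (1 - p) ^ 3 * (real (card (apexes E \<rho> e)))\<^sup>2)"
    by (intro sum_mono sq)
  ultimately have "measure_pmf.expectation ?M (\<lambda>Y. (D Y)\<^sup>2)
      \<le> 3 / (1 - p) ^ 3 * (real (card (triangles E)) + 2 * real (c4_count E \<rho>))"
    by (simp only: sum_distrib_left[symmetric] sum_card_apexes_square[OF G \<rho>])
  with \<open>integrable ?M (\<lambda>Y. (D Y)\<^sup>2)\<close> show ?thesis
    by (subst nn_integral_eq_integral) (auto intro: ennreal_leI)
qed

section \<open>Combination of the two steps\<close>

text \<open>Conditioning on \<open>Y\<close> splits the error into the Step 1 square and the Laplace
  variances; the latter are bounded uniformly in \<open>Y\<close>. The nonnegative integral passes
  through the bind without prior integrability.\<close>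

lemma two_step_mse:
  assumes G: "simple_graph n E" and w: "\<forall>u v. {u, v} \<in> E \<longrightarrow> w u v = w v u"
    and \<rho>: "\<forall>T\<in>triangles E. \<rho> T \<in> T" and \<epsilon>: "0 < \<epsilon>1" "0 < \<epsilon>2"
  defines "q \<equiv> 1 - exp (- \<epsilon>1)"
  shows "(\<integral>\<^sup>+k. ennreal ((k - real (below_count E w lam))\<^sup>2) \<partial>two_step n E w lam \<rho> \<epsilon>1 \<epsilon>2)
    \<le> ennreal (3 / q ^ 3 * (real (card (triangles E)) + 2 * real (c4_count E \<rho>))
        + 16 * real (max_degree n E) * real (card E) / (q ^ 4 * \<epsilon>2\<^sup>2))"
    (is "_ \<le> ennreal (?A + ?B)")
proof -
  define p where "p = exp (- \<epsilon>1)"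
  have p: "0 < p" "p < 1" and q: "q = 1 - p" "0 < q" using \<epsilon> by (auto simp: p_def q_def)
  let ?M = "Pi_pmf (arcs E) 0 (\<lambda>_. dlap p)"
  define F where "F Y = local_est p lam E \<rho> (noisy_weight w Y)" for Y
  define b where "b Y v = global_sens (nbhd E v) (F Y v) / \<epsilon>2" for Y v
  define D where "D Y = (\<Sum>v=1..n. F Y v (w v)) - real (below_count E w lam)" for Y
  define K where "K Y = distr (PiM {1..n} (\<lambda>v. laplace (b Y v))) borel (\<lambda>L. \<Sum>v=1..n. (F Y v (w v) + L v))" for Y
  have ts: "two_step n E w lam \<rho> \<epsilon>1 \<epsilon>2 = measure_pmf ?M \<bind> K"
    by (simp add: two_step_def Let_def p_def[symmetric] F_def[symmetric] b_def[symmetric] K_def[abs_def])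
  have b: "0 \<le> b Y v" "b Y v \<le> 2 / q\<^sup>2 * real (card (nbhd E v)) / \<epsilon>2" for Y v
    unfolding b_def F_def q using \<epsilon>(2)
    by (auto intro!: divide_nonneg_pos divide_right_mono global_sens_local_est[OF G p]
        simp del: times_divide_eq_left)
  have meas: "(\<lambda>L. \<Sum>v=1..n. (F Y v (w v) + L v)) \<in> borel_measurable (PiM {1..n} (\<lambda>v. laplace (b Y v)))" for Y
    by measurable
  have "prob_space (K Y)" for Y
    unfolding K_def using b laplace_moments(1)
    by (intro prob_space.prob_space_distr[OF prob_space_PiM] meas) auto
  \<comment> \<open>The source space is discrete, so measurability of the kernel only asks that
    every \<open>K Y\<close> be a subprobability on the Borel sets.\<close>
  then have K: "K \<in> measurable (measure_pmf ?M) (subprob_algebra borel)"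
    by (auto simp: space_subprob_algebra K_def prob_space_imp_subprob_space)
  have inner: "(\<integral>\<^sup>+k. ennreal ((k - real (below_count E w lam))\<^sup>2) \<partial>K Y)
      \<le> ennreal ((D Y)\<^sup>2) + ennreal ?B" for Y
  proof -
    have "(\<integral>\<^sup>+k. ennreal ((k - real (below_count E w lam))\<^sup>2) \<partial>K Y)
      = (\<integral>\<^sup>+L. ennreal ((D Y + (\<Sum>v=1..n. L v))\<^sup>2) \<partial>PiM {1..n} (\<lambda>v. laplace (b Y v)))"
      unfolding K_def by (subst nn_integral_distr[OF meas]) (auto simp: D_def sum.distrib algebra_simps)
    also have "\<dots> = ennreal ((D Y)\<^sup>2 + (\<Sum>v=1..n. 2 * (b Y v)\<^sup>2))"
      by (intro laplace_sum_second_moment b) simp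
    also have "\<dots> = ennreal ((D Y)\<^sup>2) + ennreal (\<Sum>v=1..n. 2 * (b Y v)\<^sup>2)"
      by (intro ennreal_plus sum_nonneg) auto
    also have "(\<Sum>v=1..n. 2 * (b Y v)\<^sup>2) \<le> (\<Sum>v=1..n. 2 * (2 / q\<^sup>2 * real (card (nbhd E v)) / \<epsilon>2)\<^sup>2)"
      by (intro sum_mono mult_left_mono power_mono b) auto
    \<comment> \<open>The 8 is the 2 of the Laplace variance times the square of the 2 in the
      sensitivity bound. The degree sum adds another factor 2, giving the 16 of the claim.\<close>
    also have "\<dots> = 8 / (q ^ 4 * \<epsilon>2\<^sup>2) * (\<Sum>v=1..n. (real (card (nbhd E v)))\<^sup>2)"
      by (simp add: sum_distrib_left power_divide power_mult_distrib)
    also have "\<dots> \<le> 8 / (q ^ 4 * \<epsilon>2\<^sup>2) * (2 * real (max_degree n E) * real (card E))"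
      using q by (intro mult_left_mono sum_degree_square_le G) auto
    finally show ?thesis by (simp add: add_left_mono ennreal_leI mult.assoc)
  qed
  have "(\<integral>\<^sup>+k. ennreal ((k - real (below_count E w lam))\<^sup>2) \<partial>two_step n E w lam \<rho> \<epsilon>1 \<epsilon>2)
    = (\<integral>\<^sup>+Y. \<integral>\<^sup>+k. ennreal ((k - real (below_count E w lam))\<^sup>2) \<partial>K Y \<partial>?M)"
    unfolding ts by (rule nn_integral_bind[OF _ K]) measurable
  also have "\<dots> \<le> (\<integral>\<^sup>+Y. ennreal ((D Y)\<^sup>2) + ennreal ?B \<partial>?M)"
    by (intro nn_integral_mono inner)
  also have "\<dots> = (\<integral>\<^sup>+Y. ennreal ((D Y)\<^sup>2) \<partial>?M) + ennreal ?B"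
    by (subst nn_integral_add) auto
  also have "\<dots> \<le> ennreal ?A + ennreal ?B"
    using step_one_mse[OF G w \<rho> p, where lam = lam] by (intro add_right_mono) (simp add: D_def F_def q)
  also have "\<dots> = ennreal (?A + ?B)"
    using q by (intro ennreal_plus[symmetric]) auto
  finally show ?thesis .
qed

lemma sets_two_step: "sets (two_step n E w lam \<rho> \<epsilon>1 \<epsilon>2) = sets borel"
  unfolding two_step_def Let_def by (rule sets_bind) auto

text \<open>Multiplying \<open>1 + x \<le> exp x\<close> by \<open>exp (- x)\<close> gives
  \<open>x * exp (- x) \<le> 1 - exp (- x)\<close>.\<close>

lemma one_minus_exp_ge:
  fixes x B :: real
  assumes "0 \<le> x" "x \<le> B"
  shows "x * exp (- B) \<le> 1 - exp (- x)"
proof -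
  have "(1 + x) * exp (- x) \<le> exp x * exp (- x)"
    by (intro mult_right_mono exp_ge_add_one_self) simp
  then have "x * exp (- x) \<le> 1 - exp (- x)" by (simp add: exp_add[symmetric] algebra_simps)
  moreover have "x * exp (- B) \<le> x * exp (- x)" using assms by (intro mult_left_mono) auto
  ultimately show ?thesis by linarith
qed

text \<open>The constant depends on \<open>B\<close> alone. A bound on \<epsilon>1 enters because
  \<open>1 - exp (- \<epsilon>1)\<close> stays below 1 while the powers of
  \<open>1 / \<epsilon>1\<close> tend to 0. Integrability is asserted too, as the integral of a
  non-integrable function is 0 by convention.\<close>

theorem mainTheorem7:
  fixes B :: real
  shows "\<exists>C>0. \<forall>n E w lam \<rho> \<epsilon>1 \<epsilon>2.
    simple_graph n E \<longrightarrow>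
    (\<forall>u v. {u, v} \<in> E \<longrightarrow> w u v = w v u) \<longrightarrow>
    (\<forall>T\<in>triangles E. \<rho> T \<in> T) \<longrightarrow>
    0 < \<epsilon>1 \<longrightarrow> \<epsilon>1 \<le> B \<longrightarrow> 0 < \<epsilon>2 \<longrightarrow>
    integrable (two_step n E w lam \<rho> \<epsilon>1 \<epsilon>2) (\<lambda>k. (k - real (below_count E w lam))\<^sup>2) \<and>
    (\<integral>k. (k - real (below_count E w lam))\<^sup>2 \<partial>two_step n E w lam \<rho> \<epsilon>1 \<epsilon>2)
      \<le> C * (real (max_degree n E) / (\<epsilon>1 ^ 4 * \<epsilon>2\<^sup>2) * real (card E)
             + real (card (triangles E)) / \<epsilon>1 ^ 3
             + real (c4_count E \<rho>) / \<epsilon>1 ^ 3)"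
\<comment> \<open>Replacing \<open>q\<close> by \<open>\<epsilon>1 / exp B\<close> yields the
  coefficients \<open>3 * exp B ^ 3\<close>, \<open>6 * exp B ^ 3\<close> and
  \<open>16 * exp B ^ 4\<close>; the witness dominates each of them.\<close>
proof (intro exI[of _ "16 * exp B ^ 4 + 6 * exp B ^ 3"] conjI allI impI)
  show "0 < 16 * exp B ^ 4 + 6 * exp B ^ 3" by (simp add: add_pos_pos)
  fix n E and w :: "nat \<Rightarrow> nat \<Rightarrow> int" and lam :: int and \<rho> and \<epsilon>1 \<epsilon>2 :: real
  assume G: "simple_graph n E" and w: "\<forall>u v. {u, v} \<in> E \<longrightarrow> w u v = w v u"
    and \<rho>: "\<forall>T\<in>triangles E. \<rho> T \<in> T" and \<epsilon>: "0 < \<epsilon>1" "\<epsilon>1 \<le> B" "0 < \<epsilon>2"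
  let ?M = "two_step n E w lam \<rho> \<epsilon>1 \<epsilon>2" and ?f = "\<lambda>k. (k - real (below_count E w lam))\<^sup>2"
  define q where "q = 1 - exp (- \<epsilon>1)"
  define d where "d = real (max_degree n E) * real (card E)"
  define t where "t = real (card (triangles E))"
  define c where "c = real (c4_count E \<rho>)"
  define R where "R = 3 / q ^ 3 * (t + 2 * c) + 16 * d / (q ^ 4 * \<epsilon>2\<^sup>2)"
  have nn: "0 \<le> d" "0 \<le> t" "0 \<le> c" by (auto simp: d_def t_def c_def)
  have q: "0 < q" "\<epsilon>1 / exp B \<le> q"
    using \<epsilon> one_minus_exp_ge[of \<epsilon>1 B] by (simp_all add: q_def exp_minus[of B] divide_inverse)
  have R0: "0 \<le> R" using nn q by (simp add: R_def)
  have le: "(\<integral>\<^sup>+k. ennreal (?f k) \<partial>?M) \<le> ennreal R"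
    using two_step_mse[OF G w \<rho> \<epsilon>(1,3), where lam = lam] by (simp add: R_def q_def d_def t_def c_def mult_ac)
  have meas: "?f \<in> borel_measurable ?M"
    by (subst measurable_cong_sets[OF sets_two_step refl]) measurable
  show "integrable ?M ?f"
    unfolding integrable_iff_bounded using meas le by (auto simp: le_less_trans)
  have "(\<integral>k. ?f k \<partial>?M) \<le> R"
    using le meas R0 by (subst integral_eq_nn_integral) (auto intro: enn2real_leI)
  also have "R \<le> 3 / (\<epsilon>1 / exp B) ^ 3 * (t + 2 * c) + 16 * d / ((\<epsilon>1 / exp B) ^ 4 * \<epsilon>2\<^sup>2)"
    unfolding R_def using q nn \<epsilon>
    by (intro add_mono mult_right_mono divide_left_mono power_mono mult_pos_pos) auto
  also have "\<dots> = 3 * exp B ^ 3 * (t / \<epsilon>1 ^ 3) + 6 * exp B ^ 3 * (c / \<epsilon>1 ^ 3)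
      + 16 * exp B ^ 4 * (d / (\<epsilon>1 ^ 4 * \<epsilon>2\<^sup>2))"
    using \<epsilon> by (simp add: power_divide field_simps)
  also have "\<dots> \<le> (16 * exp B ^ 4 + 6 * exp B ^ 3) * (t / \<epsilon>1 ^ 3) + (16 * exp B ^ 4 + 6 * exp B ^ 3) * (c / \<epsilon>1 ^ 3)
      + (16 * exp B ^ 4 + 6 * exp B ^ 3) * (d / (\<epsilon>1 ^ 4 * \<epsilon>2\<^sup>2))"
    using nn \<epsilon> by (intro add_mono mult_right_mono) (auto simp: add_increasing)
  also have "\<dots> = (16 * exp B ^ 4 + 6 * exp B ^ 3) * (real (max_degree n E) / (\<epsilon>1 ^ 4 * \<epsilon>2\<^sup>2) * real (card E)
             + real (card (triangles E)) / \<epsilon>1 ^ 3 + real (c4_count E \<rho>) / \<epsilon>1 ^ 3)"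
    by (simp add: d_def t_def c_def algebra_simps)
  finally show "(\<integral>k. ?f k \<partial>?M) \<le> \<dots>" .
qed

end
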